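(* Let $X$ be a Banach space, $K\subset X$ a nonempty compact subset, $F:K\to K$ a homeomorphism, and $\mathcal{T}:K\to L(X)$, $x\mapsto T_x$, a continuous map. Let $k,k'\in\mathbb{N}^+$ with $k\le k'$. Assume that the linear cocycle $(F,\mathcal{T})$ on $K\times X$ admits a $k$-exponential separation, with invariant $k$-dimensional continuous bundle $K\times(P_x)$ and positive invariant $k$-codimensional continuous bundle $K\times(Q_x)$, and a $k'$-exponential separation, with invariant $k'$-dimensional continuous bundle $K\times(P'_x)$ and positive invariant $k'$-codimensional continuous bundle $K\times(Q'_x)$; in particular there are $M,M'>0$ and $\gamma,\gamma'\in(0,1)$ such that $$\|T_x^nv_{Q_x}\|\le M\gamma^n\|T_x^nv_{P_x}\|,\qquad \|T_x^nv_{Q'_x}\|\le M'(\gamma')^n\|T_x^nv_{P'_x}\|$$ for any $v_{P_x}\in P_x\cap S$, $v_{Q_x}\in Q_x\cap S$, $v_{P'_x}\in P'_x\cap S$, $v_{Q'_x}\in Q'_x\cap S$, $x\in K$ and $n\in\mathbb{N}^+$. Then $P_x\subset P'_x$ and $Q'_x\subset Q_x$ for any $x\in K$.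
   Context: $L(X)$ is the space of bounded linear operators on $X$ with the operator norm; $X^*$ is the dual of $X$; $S=\{v\in X:\|v\|=1\}$. Bundles. $G(k,X)$ is the set of $k$-dimensional linear subspaces of $X$, with the gap metric $d(L_1,L_2)=\max\{\sup_{v\in L_1\cap S}\inf_{u\in L_2\cap S}\|v-u\|,\ \sup_{v\in L_2\cap S}\inf_{u\in L_1\cap S}\|v-u\|\}$ (similarly $G(k,X^* )$). For a family $\{P_x\}_{x\in K}$ of $k$-dimensional subspaces of $X$, $K\times(P_x)$ is a $k$-dimensional continuous bundle if $x\mapsto P_x\in G(k,X)$ is continuous. For a family $\{Q_x\}_{x\in K}$ of closed $k$-codimensional subspaces, $K\times(Q_x)$ is a $k$-codimensional continuous bundle if there is a $k$-dimensional continuous bundle $K\times(L_x)\subset K\times X^*$ with $\mathrm{Ker}(L_x)=\{v\in X:\ell(v)=0\ \forall \ell\in L_x\}=Q_x$ for each $x\in K$. Cocycle. The linear cocycle $(F,\mathcal{T})$ on $K\times X$ is the map $(x,v)\mapsto(F(x),T_xv)$. Write $T_x^0=\mathrm{Id}$ and $T_x^n=T_{F^{n-1}(x)}\circ T_x^{n-1}$ for $n\ge1$. Exponential separation. $(F,\mathcal{T})$ admits a $k$-exponential separation if (i) there are a $k$-dimensional continuous bundle $K\times(P_x)$ and a $k$-codimensional continuous bundle $K\times(Q_x)$ with $X=P_x\oplus Q_x$ for any $x\in K$; (ii) $T_xP_x=P_{F(x)}$ and $T_xQ_x\subset Q_{F(x)}$ for any $x\in K$; (iii) there are $M>0$ and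 $\gamma\in(0,1)$ such that $\|T_x^nw\|\le M\gamma^n\|T_x^nv\|$ for any $v\in P_x\cap S$, $w\in Q_x\cap S$, $x\in K$, $n\in\mathbb{N}^+$. *)

theory Defs
  imports "HOL-Analysis.Analysis"
begin

definition grassmannian :: "nat \<Rightarrow> 'a::real_normed_vector set set" where
  "grassmannian k = {V. \<exists>B. finite B \<and> independent B \<and> card B = k \<and> span B = V}"

text \<open>The real-valued suprema and infima below are meaningful for \<open>k \<ge> 1\<close>: then both unit
  spheres are nonempty and the distances between their points lie in \<open>[0, 2]\<close>.\<close>

definition gap :: "'a::real_normed_vector set \<Rightarrow> 'a set \<Rightarrow> real" where
  "gap L1 L2 = max (SUP v\<in>L1 \<inter> sphere 0 1. INF u\<in>L2 \<inter> sphere 0 1. norm (v - u))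
                   (SUP v\<in>L2 \<inter> sphere 0 1. INF u\<in>L1 \<inter> sphere 0 1. norm (v - u))"

definition continuous_bundle ::
    "nat \<Rightarrow> 'b::metric_space set \<Rightarrow> ('b \<Rightarrow> 'a::real_normed_vector set) \<Rightarrow> bool" where
  "continuous_bundle k K P \<longleftrightarrow>
     (\<forall>x\<in>K. P x \<in> grassmannian k) \<and>
     (\<forall>x\<in>K. ((\<lambda>y. gap (P y) (P x)) \<longlongrightarrow> 0) (at x within K))"

definition direct_sum :: "'a::real_vector set \<Rightarrow> 'a set \<Rightarrow> bool" where
  "direct_sum P Q \<longleftrightarrow>
     subspace P \<and> subspace Q \<and> P \<inter> Q = {0} \<and> {p + q | p q. p \<in> P \<and> q \<in> Q} = UNIV"

definition closed_codim_subspace :: "nat \<Rightarrow> 'a::real_normed_vector set \<Rightarrow> bool" where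
  "closed_codim_subspace k Q \<longleftrightarrow>
     subspace Q \<and> closed Q \<and> (\<exists>V\<in>grassmannian k. direct_sum V Q)"

definition common_kernel :: "('a::real_normed_vector \<Rightarrow>\<^sub>L real) set \<Rightarrow> 'a set" where
  "common_kernel L = {v. \<forall>l\<in>L. blinfun_apply l v = 0}"

definition continuous_cobundle ::
    "nat \<Rightarrow> 'b::metric_space set \<Rightarrow> ('b \<Rightarrow> 'a::real_normed_vector set) \<Rightarrow> bool" where
  "continuous_cobundle k K Q \<longleftrightarrow>
     (\<forall>x\<in>K. closed_codim_subspace k (Q x)) \<and>
     (\<exists>L :: 'b \<Rightarrow> ('a \<Rightarrow>\<^sub>L real) set. continuous_bundle k K L \<and> (\<forall>x\<in>K. common_kernel (L x) = Q x))"

primrec cocycle_iter ::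
    "('b \<Rightarrow> 'b) \<Rightarrow> ('b \<Rightarrow> 'a::real_normed_vector \<Rightarrow>\<^sub>L 'a) \<Rightarrow> nat \<Rightarrow> 'b \<Rightarrow> 'a \<Rightarrow>\<^sub>L 'a" where
  "cocycle_iter F T 0 x = id_blinfun"
| "cocycle_iter F T (Suc n) x = T ((F ^^ n) x) o\<^sub>L cocycle_iter F T n x"

definition exponential_separation ::
    "nat \<Rightarrow> 'b::metric_space set \<Rightarrow> ('b \<Rightarrow> 'b) \<Rightarrow> ('b \<Rightarrow> 'a::real_normed_vector \<Rightarrow>\<^sub>L 'a) \<Rightarrow>
     ('b \<Rightarrow> 'a set) \<Rightarrow> ('b \<Rightarrow> 'a set) \<Rightarrow> bool" where
  "exponential_separation k K F T P Q \<longleftrightarrow>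
     continuous_bundle k K P \<and>
     continuous_cobundle k K Q \<and>
     (\<forall>x\<in>K. direct_sum (P x) (Q x)) \<and>
     (\<forall>x\<in>K. blinfun_apply (T x) ` P x = P (F x)) \<and>
     (\<forall>x\<in>K. blinfun_apply (T x) ` Q x \<subseteq> Q (F x)) \<and>
     (\<exists>M>0. \<exists>\<gamma>\<in>{0<..<1}. \<forall>x\<in>K. \<forall>v\<in>P x \<inter> sphere 0 1. \<forall>w\<in>Q x \<inter> sphere 0 1. \<forall>n\<ge>1.
        norm (blinfun_apply (cocycle_iter F T n x) w)
          \<le> M * \<gamma> ^ n * norm (blinfun_apply (cocycle_iter F T n x) v))"

end

theory Submission
  imports Defs
begin

text \<open>
  Fix \<open>x \<in> K\<close> and write \<open>T\<^sup>n\<close> for the iterates along its orbit. The decomposition along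
  \<open>P \<oplus> Q\<close> is governed by growth: up to constant factors, a vector with nonzero
  \<open>P\<close>-component \<open>p\<close> eventually grows like \<open>T\<^sup>n p\<close>, and \<open>T\<^sup>n p\<close> never vanishes because \<open>T\<close> maps
  \<open>P x\<close> onto a space of the same dimension.

  For \<open>Q' x \<subseteq> Q x\<close>, suppose that \<open>w \<in> Q' x\<close> has \<open>P\<close>-component \<open>p \<noteq> 0\<close>. As \<open>dim (P' x) \<ge> dim (P x)\<close>,
  counting dimensions gives \<open>0 \<noteq> v \<in> P' x\<close> whose \<open>P\<close>-component is a multiple of \<open>p\<close>
  (\<open>exists_component_multiple\<close>). Then \<open>T\<^sup>n v\<close> grows at most like \<open>T\<^sup>n p\<close>, hence at most like \<open>T\<^sup>n w\<close>,
  whereas the second separation makes \<open>T\<^sup>n w\<close> exponentially smaller than \<open>T\<^sup>n v\<close>. This is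
  absurd (\<open>slow_bundle_subset\<close>).

  For \<open>P x \<subseteq> P' x\<close> the orbit is followed backwards. Let \<open>v \<in> P x\<close> have components \<open>p'\<close> and \<open>q'\<close>
  along \<open>P' x \<oplus> Q' x\<close>, and let \<open>v\<^sub>n = p\<^sub>n + q\<^sub>n\<close> be a preimage of \<open>v\<close> under \<open>T\<^sup>n\<close> in the fibre of \<open>P\<close>,
  decomposed in the same manner. If \<open>p' = 0\<close>, then \<open>v \<in> Q' x \<subseteq> Q x\<close>, so \<open>v = 0\<close>;
  otherwise \<open>p\<^sub>n \<noteq> 0\<close>, as \<open>T\<^sup>n\<close> maps \<open>p\<^sub>n\<close> to \<open>p'\<close>. The first part gives \<open>q\<^sub>n \<in> Q' \<subseteq> Q\<close>, so that \<open>p\<^sub>n\<close> is a vector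
  of \<open>P\<close> plus a vector of \<open>Q\<close>. The angle between \<open>P\<close> and \<open>Q\<close> is bounded below on the compact base
  (\<open>uniform_angle\<close>); therefore \<open>\<parallel>v\<^sub>n\<parallel>\<close>, and with it \<open>\<parallel>q\<^sub>n\<parallel>\<close>, is at most a constant times
  \<open>\<parallel>p\<^sub>n\<parallel>\<close>. The second separation applied to \<open>p\<^sub>n\<close> and \<open>q\<^sub>n\<close> now bounds \<open>\<parallel>q'\<parallel>\<close> by a constant times
  \<open>\<gamma>'\<^sup>n\<close> for every \<open>n\<close>, so \<open>q' = 0\<close>.
\<close>

section \<open>Finite-dimensional subspaces of a normed space\<close>

lemma closed_if_bounded_parts_compact:
  fixes V :: "'a::real_normed_vector set"
  assumes "\<And>r. compact (V \<inter> cball 0 r)"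
  shows "closed V"
  unfolding closed_sequential_limits
proof (intro allI impI)
  fix s l assume s: "(\<forall>n. s n \<in> V) \<and> s \<longlonglongrightarrow> l"
  then have "Bseq s" using convergentI convergent_imp_Bseq by blast
  then obtain r where "\<forall>n. norm (s n) \<le> r" by (auto simp: Bseq_def)
  then have "\<forall>n. s n \<in> V \<inter> cball 0 r" using s by auto
  moreover have "closed (V \<inter> cball 0 r)" using assms compact_imp_closed by blast
  ultimately show "l \<in> V" using s by (meson IntD1 closed_sequentially)
qed

text \<open>
  The ball of \<open>span (insert b B)\<close> is a closed part of the continuous image of a product of a ball
  of \<open>span B\<close> and an interval: since \<open>span B\<close> is closed, \<open>b\<close> has positive distance \<open>d\<close> from it,
  and this controls the coefficient of \<open>b\<close> by the norm.
\<close>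

lemma compact_span_Int_cball:
  fixes B :: "'a::real_normed_vector set"
  assumes "finite B"
  shows "compact (span B \<inter> cball 0 r)"
  using assms
proof (induction B arbitrary: r rule: finite_induct)
  case empty
  have "span {} \<inter> cball (0::'a) r \<subseteq> {0}" by auto
  then show ?case by (meson finite.emptyI finite.insertI finite_imp_compact finite_subset)
next
  case (insert b B)
  have cl: "closed (span B)" by (rule closed_if_bounded_parts_compact) (rule insert.IH)
  show ?case
  proof (cases "b \<in> span B")
    case True
    then show ?thesis using insert.IH by (simp add: span_redundant)
  next
    case False
    define d where "d = infdist b (span B)"
    have "span B \<noteq> {}" using span_0 by blast
    then have d: "d > 0" "\<And>v. v \<in> span B \<Longrightarrow> d \<le> dist b v"
      using infdist_pos_not_in_closed[OF cl _ False] unfolding d_def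
      by (simp, simp add: infdist_le)
    have coeff: "\<bar>t\<bar> * d \<le> norm (v + t *\<^sub>R b)" if "v \<in> span B" for v t
    proof (cases "t = 0")
      case False
      have "(-1/t) *\<^sub>R v \<in> span B" using that by (rule span_scale)
      from d(2)[OF this] have "d \<le> norm (b + (1/t) *\<^sub>R v)" by (simp add: dist_norm)
      also have "b + (1/t) *\<^sub>R v = (1/t) *\<^sub>R (v + t *\<^sub>R b)"
        using False by (simp add: scaleR_add_right)
      also have "norm \<dots> = norm (v + t *\<^sub>R b) / \<bar>t\<bar>" by simp
      finally show ?thesis using False by (simp add: pos_le_divide_eq mult.commute)
    qed simp
    define R where "R = r + r / d * norm b"
    define A where "A = (\<lambda>(v, t). v + t *\<^sub>R b) ` ((span B \<inter> cball 0 R) \<times> {- (r/d)..r/d})"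
    have "compact A" unfolding A_def
      by (intro compact_continuous_image compact_Times insert.IH)
        (auto simp: case_prod_unfold intro!: continuous_intros)
    moreover have "span (insert b B) \<inter> cball 0 r = A \<inter> cball 0 r"
    proof (intro equalityI subsetI)
      fix y assume y: "y \<in> span (insert b B) \<inter> cball 0 r"
      then obtain t where t: "y - t *\<^sub>R b \<in> span B" by (auto simp: span_insert)
      have yr: "norm y \<le> r" using y by simp
      have "\<bar>t\<bar> * d \<le> r" using coeff[OF t, of t] yr by simp
      then have tr: "\<bar>t\<bar> \<le> r / d" using d by (simp add: field_simps)
      have "norm (y - t *\<^sub>R b) \<le> norm y + \<bar>t\<bar> * norm b"
        by (metis norm_scaleR norm_triangle_ineq4)
      also have "\<dots> \<le> R" unfolding R_def using yr tr by (intro add_mono mult_right_mono) auto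
      finally have "(y - t *\<^sub>R b, t) \<in> (span B \<inter> cball 0 R) \<times> {- (r/d)..r/d}"
        using t tr by (auto simp: abs_le_iff)
      from imageI[OF this, of "\<lambda>(v, t). v + t *\<^sub>R b"] show "y \<in> A \<inter> cball 0 r"
        using y by (simp add: A_def)
    next
      fix y assume y: "y \<in> A \<inter> cball 0 r"
      then obtain v t where "v \<in> span B" "y = v + t *\<^sub>R b" by (auto simp: A_def)
      then have "y \<in> span (insert b B)"
        by (metis insertI1 span_add span_base span_mono span_scale subset_insertI subsetD)
      then show "y \<in> span (insert b B) \<inter> cball 0 r" using y by simp
    qed
    ultimately show ?thesis by (simp add: compact_Int_closed)
  qed
qed

lemma grassmannian_subspace: "V \<in> grassmannian k \<Longrightarrow> subspace V"
  by (auto simp: grassmannian_def)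

lemma grassmannian_compact_sphere:
  fixes V :: "'a::real_normed_vector set"
  assumes "V \<in> grassmannian k"
  shows "compact (V \<inter> sphere 0 1)"
proof -
  have "compact (V \<inter> cball 0 1)"
    using assms compact_span_Int_cball by (auto simp: grassmannian_def)
  then have "compact ((V \<inter> cball 0 1) \<inter> sphere 0 1)" 
    by (rule compact_Int_closed) (auto simp: sphere_def intro!: closed_Collect_eq continuous_intros)
  moreover have "(V \<inter> cball 0 1) \<inter> sphere 0 1 = V \<inter> sphere 0 1" by auto
  ultimately show ?thesis by simp
qed

lemma normalize_in_sphere:
  assumes "subspace V" "v \<in> V" "v \<noteq> 0"
  shows "v /\<^sub>R norm v \<in> V \<inter> sphere 0 1"
  using assms by (auto simp: subspace_scale)

lemma grassmannian_sphere_nonempty: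
  fixes V :: "'a::real_normed_vector set"
  assumes "V \<in> grassmannian k" "1 \<le> k"
  shows "V \<inter> sphere 0 1 \<noteq> {}"
proof -
  obtain B where B: "independent B" "card B = k" "span B = V"
    using assms by (auto simp: grassmannian_def)
  then obtain b where "b \<in> B" using assms(2) by fastforce
  then have "b \<in> V" "b \<noteq> 0" using B dependent_zero span_base by blast+
  then show ?thesis using normalize_in_sphere assms(1) grassmannian_subspace by blast
qed

text \<open>
  A spanning set with no more elements than an independent set is itself independent, so a
  basis of \<open>V\<close> is mapped to a basis of \<open>W\<close>.
\<close>

lemma linear_onto_equal_dim_inj:
  fixes f :: "'a::real_normed_vector \<Rightarrow> 'b::real_normed_vector"
  assumes "linear f" "V \<in> grassmannian k" "W \<in> grassmannian k" "f ` V = W"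
  shows "inj_on f V"
proof -
  obtain B where B: "finite B" "independent B" "card B = k" "span B = V"
    using assms(2) by (auto simp: grassmannian_def)
  obtain C where C: "finite C" "independent C" "card C = k" "span C = W"
    using assms(3) by (auto simp: grassmannian_def)
  have spans: "span (f ` B) = W" using B assms linear_span_image by metis
  have "card C \<le> card (f ` B)"
    using independent_span_bound[of "f ` B" C] B C spans span_superset by blast
  then have card: "card (f ` B) = k" using B C card_image_le[of B f] by simp
  have "independent (f ` B)"
  proof
    assume "dependent (f ` B)"
    then obtain a where a: "a \<in> f ` B" "a \<in> span (f ` B - {a})" by (auto simp: dependent_def)
    have "span (f ` B - {a}) = W" using a spans by (metis insert_Diff span_redundant)
    then have "card C \<le> card (f ` B - {a})"
      using independent_span_bound[of "f ` B - {a}" C] B C span_superset by blast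
    then show False using a(1) card C(3) B(1) card_Diff1_less[of "f ` B" a] by simp
  qed
  moreover have "inj_on f B" using card B by (simp add: eq_card_imp_inj_on)
  ultimately show ?thesis
    using linear_inj_on_span_independent_image[OF assms(1)] B by blast
qed

section \<open>Direct sums\<close>

lemma direct_sumE:
  assumes "direct_sum P Q"
  obtains p q where "p \<in> P" "q \<in> Q" "v = p + q"
proof -
  have "v \<in> {p + q | p q. p \<in> P \<and> q \<in> Q}" using assms by (simp add: direct_sum_def)
  then show ?thesis using that by blast
qed

lemma direct_sum_unique:
  assumes "direct_sum P Q" "p \<in> P" "p1 \<in> P" "q \<in> Q" "q1 \<in> Q" "p + q = p1 + q1"
  shows "p = p1" "q = q1"
proof -
  have "p - p1 = q1 - q" using assms(6) by (simp add: algebra_simps)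
  then have "p - p1 \<in> P \<inter> Q" using assms by (metis IntI direct_sum_def subspace_diff)
  moreover have "P \<inter> Q = {0}" using assms(1) by (simp add: direct_sum_def)
  ultimately show "p = p1" by simp
  then show "q = q1" using assms(6) by simp
qed

lemma direct_sum_projection:
  assumes "direct_sum P Q"
  obtains \<pi> where "linear \<pi>" "\<And>v. \<pi> v \<in> P" "\<And>v. v - \<pi> v \<in> Q"
proof -
  have "\<forall>v. \<exists>p. p \<in> P \<and> v - p \<in> Q"
  proof
    fix v
    obtain p q where "p \<in> P" "q \<in> Q" "v = p + q" using direct_sumE[OF assms] .
    then show "\<exists>p. p \<in> P \<and> v - p \<in> Q" by (intro exI[of _ p]) simp
  qed
  then obtain \<pi> where \<pi>: "\<And>v. \<pi> v \<in> P" "\<And>v. v - \<pi> v \<in> Q" by metis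
  have sub: "subspace P" "subspace Q" using assms by (auto simp: direct_sum_def)
  have unique: "\<pi> v = p" if "p \<in> P" "v - p \<in> Q" for v p
    by (rule direct_sum_unique(1)[OF assms \<pi>(1) that(1) \<pi>(2)[of v] that(2)]) simp
  have "linear \<pi>"
  proof
    fix v w
    show "\<pi> (v + w) = \<pi> v + \<pi> w"
      by (rule unique) (use subspace_add[OF sub(1) \<pi>(1) \<pi>(1), of v w]
          subspace_add[OF sub(2) \<pi>(2) \<pi>(2), of v w] in \<open>simp_all add: algebra_simps\<close>)
  next
    fix r v
    show "\<pi> (r *\<^sub>R v) = r *\<^sub>R \<pi> v"
      by (rule unique) (use subspace_scale[OF sub(1) \<pi>(1), of r v]
          subspace_scale[OF sub(2) \<pi>(2), of r v] in \<open>simp_all add: algebra_simps\<close>)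
  qed
  then show ?thesis using \<pi> that by blast
qed

text \<open>
  The projection to \<open>P\<close> along \<open>Q\<close> either kills a nonzero vector of \<open>P'\<close>, which then serves
  with \<open>a = 0\<close>, or it is injective on \<open>P'\<close> and hence, by dimension, maps \<open>P'\<close> onto \<open>P\<close>, so \<open>p\<close>
  itself is the \<open>P\<close>-component of a vector of \<open>P'\<close>.
\<close>

lemma exists_component_multiple:
  fixes P P' Q :: "'a::real_normed_vector set"
  assumes ds: "direct_sum P Q" and P: "P \<in> grassmannian k" and P': "P' \<in> grassmannian k'"
    and "k \<le> k'" and p: "p \<in> P" "p \<noteq> 0"
  obtains v a q where "v \<in> P'" "v \<noteq> 0" "q \<in> Q" "v = a *\<^sub>R p + q"
proof -
  obtain \<pi> where \<pi>: "linear \<pi>" "\<And>v. \<pi> v \<in> P" "\<And>v. v - \<pi> v \<in> Q"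
    using direct_sum_projection[OF ds] by metis
  show ?thesis
  proof (cases "inj_on \<pi> P'")
    case False
    then obtain v where v: "v \<in> P'" "v \<noteq> 0" "\<pi> v = 0"
      using linear_inj_on_iff_eq_0[OF \<pi>(1) grassmannian_subspace[OF P']] by blast
    show ?thesis using that[of v v 0] v \<pi>(3)[of v] by simp
  next
    case True
    obtain B' where B': "finite B'" "independent B'" "card B' = k'" "span B' = P'"
      using P' by (auto simp: grassmannian_def)
    obtain B where B: "finite B" "card B = k" "span B = P"
      using P by (auto simp: grassmannian_def)
    have ind: "independent (\<pi> ` B')"
      using linear_independent_injective_image[OF \<pi>(1) B'(2)] True B'(4) by simp
    have card: "card (\<pi> ` B') = k'"
      using B' True by (metis card_image inj_on_subset span_superset)
    have "p \<in> span (\<pi> ` B')"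
    proof (rule ccontr)
      assume np: "p \<notin> span (\<pi> ` B')"
      then have "independent (insert p (\<pi> ` B'))" using ind by (simp add: independent_insert)
      moreover have "insert p (\<pi> ` B') \<subseteq> span B" using \<pi>(2) p B by auto
      ultimately have "card (insert p (\<pi> ` B')) \<le> k"
        using independent_span_bound[OF B(1), of "insert p (\<pi> ` B')"] B(2) by simp
      moreover have "p \<notin> \<pi> ` B'" using np span_base[of p "\<pi> ` B'"] by metis
      ultimately show False using card B'(1) \<open>k \<le> k'\<close> by simp
    qed
    then obtain v where v: "v \<in> P'" "p = \<pi> v"
      using linear_span_image[OF \<pi>(1)] B'(4) by blast
    have "v \<noteq> 0" using v p linear_0[OF \<pi>(1)] by auto
    then show ?thesis using that[of v "v - \<pi> v" 1] v \<pi>(3)[of v] by simp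
  qed
qed

section \<open>Continuous bundles over a compact base\<close>

lemma gap_commute: "gap L1 L2 = gap L2 L1"
  by (simp add: gap_def max.commute)

lemma gap_self:
  fixes L :: "'a::real_normed_vector set"
  assumes "L \<inter> sphere 0 1 \<noteq> {}"
  shows "gap L L = 0"
proof -
  have "(INF u\<in>L \<inter> sphere 0 1. norm (v - u)) = 0" if v: "v \<in> L \<inter> sphere 0 1" for v
  proof (rule antisym)
    show "(INF u\<in>L \<inter> sphere 0 1. norm (v - u)) \<le> 0"
      by (rule cINF_lower2[OF _ v]) (auto intro!: bdd_belowI[of _ 0])
    show "0 \<le> (INF u\<in>L \<inter> sphere 0 1. norm (v - u))"
      using assms by (intro cINF_greatest) auto
  qed
  then have "(SUP v\<in>L \<inter> sphere 0 1. INF u\<in>L \<inter> sphere 0 1. norm (v - u))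
      = (SUP v\<in>L \<inter> sphere 0 1. 0::real)" by (intro SUP_cong) auto
  then show ?thesis using assms by (simp add: gap_def)
qed

lemma gap_approx:
  fixes L1 L2 :: "'a::real_normed_vector set"
  assumes v: "v \<in> L1 \<inter> sphere 0 1" and ne: "L2 \<inter> sphere 0 1 \<noteq> {}" and "e > 0"
  obtains u where "u \<in> L2 \<inter> sphere 0 1" "norm (v - u) < gap L1 L2 + e"
proof -
  let ?d = "\<lambda>v. INF u\<in>L2 \<inter> sphere 0 1. norm (v - u)"
  obtain u0 where u0: "u0 \<in> L2 \<inter> sphere 0 1" using ne by blast
  have bdd: "bdd_below ((\<lambda>u. norm (v - u)) ` (L2 \<inter> sphere 0 1))" for v
    by (auto intro!: bdd_belowI[of _ 0])
  have "?d w \<le> 2" if "w \<in> L1 \<inter> sphere 0 1" for w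
    by (rule cINF_lower2[OF bdd u0]) (use that u0 norm_triangle_ineq4[of w u0] in auto)
  then have "bdd_above (?d ` (L1 \<inter> sphere 0 1))" by (auto intro!: bdd_aboveI[of _ 2])
  then have "?d v \<le> (SUP v\<in>L1 \<inter> sphere 0 1. ?d v)" using v by (intro cSUP_upper)
  then have "?d v < gap L1 L2 + e" using \<open>e > 0\<close> by (simp add: gap_def)
  then show ?thesis using that cINF_less_iff[OF ne bdd] by blast
qed

lemma continuous_bundle_gap_tendsto:
  assumes cb: "continuous_bundle k K P" and "1 \<le> k"
    and x: "\<And>n::nat. x n \<in> K" "y \<in> K" "x \<longlonglongrightarrow> y"
  shows "(\<lambda>n. gap (P (x n)) (P y)) \<longlonglongrightarrow> 0"
proof -
  have "gap (P y) (P y) = 0"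
    using cb x(2) \<open>1 \<le> k\<close> gap_self grassmannian_sphere_nonempty
    by (metis continuous_bundle_def)
  then have "continuous (at y within K) (\<lambda>z. gap (P z) (P y))"
    using cb x(2) by (simp add: continuous_within continuous_bundle_def)
  then have "((\<lambda>z. gap (P z) (P y)) \<circ> x) \<longlonglongrightarrow> gap (P y) (P y)"
    unfolding continuous_within_sequentially using x by blast
  then show ?thesis using \<open>gap (P y) (P y) = 0\<close> by (simp add: o_def)
qed

text \<open>
  Up to an error that tends to \<open>0\<close> with the gap, the vectors \<open>p n\<close> may be replaced by points
  of the unit sphere of \<open>P y\<close>, which is compact because \<open>P y\<close> has finite dimension.
\<close>

lemma continuous_bundle_unit_limit:
  assumes cb: "continuous_bundle k K P" and k: "1 \<le> k"
    and x: "\<And>n::nat. x n \<in> K" "y \<in> K" "x \<longlonglongrightarrow> y"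
    and p: "\<And>n. p n \<in> P (x n) \<inter> sphere 0 1"
  obtains r u where "strict_mono r" "u \<in> P y \<inter> sphere 0 1" "(p \<circ> r) \<longlonglongrightarrow> u"
proof -
  have gr: "P y \<in> grassmannian k" using cb x(2) by (simp add: continuous_bundle_def)
  define h where "h n = gap (P (x n)) (P y) + 1 / real (Suc n)" for n
  have "h \<longlonglongrightarrow> 0" unfolding h_def
    using tendsto_add[OF continuous_bundle_gap_tendsto[OF cb k x] lim_1_over_n[THEN LIMSEQ_Suc]]
    by simp
  have "\<forall>n. \<exists>u. u \<in> P y \<inter> sphere 0 1 \<and> norm (p n - u) < h n"
    using gap_approx[OF p grassmannian_sphere_nonempty[OF gr k]] unfolding h_def
    by (metis of_nat_0_less_iff zero_less_Suc zero_less_divide_1_iff)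
  then obtain u where u: "\<And>n. u n \<in> P y \<inter> sphere 0 1" "\<And>n. norm (p n - u n) < h n" by metis
  obtain l r where l: "l \<in> P y \<inter> sphere 0 1" "strict_mono r" "(u \<circ> r) \<longlonglongrightarrow> l"
    using grassmannian_compact_sphere[OF gr] u(1) unfolding compact_def by metis
  have "(\<lambda>n. p n - u n) \<longlonglongrightarrow> 0"
    by (rule Lim_null_comparison[OF _ \<open>h \<longlonglongrightarrow> 0\<close>]) (simp add: less_imp_le[OF u(2)])
  then have "((\<lambda>n. p n - u n) \<circ> r) \<longlonglongrightarrow> 0" using l(2) LIMSEQ_subseq_LIMSEQ by blast
  from tendsto_add[OF this l(3)] have "(p \<circ> r) \<longlonglongrightarrow> l" by (simp add: o_def)
  then show ?thesis using that l by blast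
qed

lemma continuous_bundle_unit_approx:
  assumes cb: "continuous_bundle k K P" and k: "1 \<le> k"
    and x: "\<And>n::nat. x n \<in> K" "y \<in> K" "x \<longlonglongrightarrow> y"
    and u: "u \<in> P y \<inter> sphere 0 1"
  obtains p where "\<And>n. p n \<in> P (x n)" "p \<longlonglongrightarrow> u"
proof -
  define h where "h n = gap (P (x n)) (P y) + 1 / real (Suc n)" for n
  have "h \<longlonglongrightarrow> 0" unfolding h_def
    using tendsto_add[OF continuous_bundle_gap_tendsto[OF cb k x] lim_1_over_n[THEN LIMSEQ_Suc]]
    by simp
  have "\<exists>p. p \<in> P (x n) \<and> norm (u - p) < h n" for n
  proof -
    have "P (x n) \<inter> sphere 0 1 \<noteq> {}"
      using cb x(1) k grassmannian_sphere_nonempty by (metis continuous_bundle_def)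
    from gap_approx[OF u this, of "1 / real (Suc n)"] show ?thesis
      unfolding h_def by (metis IntD1 gap_commute of_nat_0_less_iff zero_less_Suc
          zero_less_divide_1_iff)
  qed
  then obtain p where p: "\<And>n. p n \<in> P (x n)" "\<And>n. norm (u - p n) < h n" by metis
  have "(\<lambda>n. p n - u) \<longlonglongrightarrow> 0"
    by (rule Lim_null_comparison[OF _ \<open>h \<longlonglongrightarrow> 0\<close>])
      (simp add: norm_minus_commute[of _ u] less_imp_le[OF p(2)])
  then have "p \<longlonglongrightarrow> u" using LIM_zero_cancel by blast
  then show ?thesis using that p by blast
qed

text \<open>
  The projection to \<open>P\<close> along \<open>Q\<close> is bounded uniformly over the base. Otherwise there are unit
  vectors \<open>p n\<close> of \<open>P\<close> whose distance to \<open>Q\<close>, over the same point, tends to \<open>0\<close>. Along a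
  subsequence they converge to a unit vector \<open>u\<close> of \<open>P y\<close>; as every functional that defines
  \<open>Q y\<close> is a limit of functionals that vanish on the neighbouring fibres of \<open>Q\<close>, the
  vector \<open>u\<close> lies in \<open>Q y\<close> too.
\<close>

lemma uniform_angle:
  fixes P Q :: "'b::metric_space \<Rightarrow> 'a::real_normed_vector set"
  assumes K: "compact K" and k: "1 \<le> k" and P: "continuous_bundle k K P"
    and Q: "continuous_cobundle k K Q" and ds: "\<And>x. x \<in> K \<Longrightarrow> direct_sum (P x) (Q x)"
  obtains C where "C > 0"
    "\<And>x p q. x \<in> K \<Longrightarrow> p \<in> P x \<Longrightarrow> q \<in> Q x \<Longrightarrow> norm p \<le> C * norm (p + q)"
proof -
  obtain L :: "'b \<Rightarrow> ('a \<Rightarrow>\<^sub>L real) set"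
    where L: "continuous_bundle k K L" "\<And>x. x \<in> K \<Longrightarrow> common_kernel (L x) = Q x"
    using Q unfolding continuous_cobundle_def by blast
  have "\<exists>n. \<forall>x\<in>K. \<forall>p\<in>P x. \<forall>q\<in>Q x. norm p \<le> real (Suc n) * norm (p + q)"
  proof (rule ccontr)
    assume "\<not> ?thesis"
    then have "\<forall>n. \<exists>x p q. x \<in> K \<and> p \<in> P x \<and> q \<in> Q x \<and> real (Suc n) * norm (p + q) < norm p"
      by (meson not_le)
    then obtain x p q where xK: "\<And>n. x n \<in> K" and p: "\<And>n. p n \<in> P (x n)"
      and q: "\<And>n. q n \<in> Q (x n)" and lt: "\<And>n. real (Suc n) * norm (p n + q n) < norm (p n)"
      by metis
    have p0: "norm (p n) > 0" for n
      using lt[of n] by (smt (verit) mult_nonneg_nonneg norm_ge_zero of_nat_0_le_iff)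
    define p1 q1 where "p1 n = p n /\<^sub>R norm (p n)" and "q1 n = q n /\<^sub>R norm (p n)" for n
    have sub: "subspace (P (x n))" "subspace (Q (x n))" for n
      using ds[OF xK] by (auto simp: direct_sum_def)
    have p1: "p1 n \<in> P (x n) \<inter> sphere 0 1" for n
      unfolding p1_def using p0[of n] by (intro normalize_in_sphere sub p) auto
    have q1: "q1 n \<in> Q (x n)" for n
      unfolding q1_def by (intro subspace_scale sub q)
    have sum: "norm (p1 n + q1 n) \<le> 1 / real (Suc n)" for n
    proof -
      have "p1 n + q1 n = (p n + q n) /\<^sub>R norm (p n)"
        by (simp add: p1_def q1_def scaleR_add_right)
      then have "norm (p1 n + q1 n) = norm (p n + q n) / norm (p n)"
        by (simp add: divide_inverse_commute)
      also have "\<dots> \<le> 1 / real (Suc n)" using lt[of n] p0[of n]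
        by (simp add: divide_simps mult.commute)
      finally show ?thesis .
    qed
    have sum0: "(\<lambda>n. p1 n + q1 n) \<longlonglongrightarrow> 0"
      by (rule Lim_null_comparison[OF _ lim_1_over_n[THEN LIMSEQ_Suc]]) (use sum in auto)
    obtain y r where y: "y \<in> K" "strict_mono r" "(x \<circ> r) \<longlonglongrightarrow> y"
      using K xK unfolding compact_def by metis
    obtain s u where s: "strict_mono s" "u \<in> P y \<inter> sphere 0 1" "((p1 \<circ> r) \<circ> s) \<longlonglongrightarrow> u"
      by (rule continuous_bundle_unit_limit[OF P k _ y(1,3), of "p1 \<circ> r"])
        (use xK p1 in auto)
    define t where "t = r \<circ> s"
    have t: "strict_mono t" unfolding t_def using y(2) s(1) by (rule strict_mono_o)
    have xt: "(x \<circ> t) \<longlonglongrightarrow> y"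
      using LIMSEQ_subseq_LIMSEQ[OF y(3) s(1)] by (simp add: t_def o_assoc)
    have pt: "(\<lambda>n. p1 (t n)) \<longlonglongrightarrow> u" using s(3) by (simp add: t_def o_def)
    have "(\<lambda>n. p1 (t n) + q1 (t n)) \<longlonglongrightarrow> 0"
      using LIMSEQ_subseq_LIMSEQ[OF sum0 t] by (simp add: o_def)
    from tendsto_diff[OF this pt] have qt: "(\<lambda>n. q1 (t n)) \<longlonglongrightarrow> - u" by simp
    have unit: "blinfun_apply l u = 0" if l: "l \<in> L y \<inter> sphere 0 1" for l
    proof -
      obtain m where m: "\<And>n. m n \<in> L ((x \<circ> t) n)" "m \<longlonglongrightarrow> l"
        by (rule continuous_bundle_unit_approx[OF L(1) k _ y(1) xt l]) (use xK in auto)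
      have "blinfun_apply (m n) (q1 (t n)) = 0" for n
      proof -
        have "q1 (t n) \<in> common_kernel (L (x (t n)))" using q1 L(2)[OF xK] by simp
        then show ?thesis using m(1)[of n] by (simp add: common_kernel_def)
      qed
      then have "(\<lambda>n. 0) \<longlonglongrightarrow> blinfun_apply l (- u)"
        using blinfun.tendsto[OF m(2) qt] by simp
      then show ?thesis by (simp add: LIMSEQ_const_iff blinfun.minus_right)
    qed
    have "blinfun_apply l u = 0" if l: "l \<in> L y" for l
    proof (cases "l = 0")
      case False
      have "subspace (L y)"
        using L(1) y(1) grassmannian_subspace by (auto simp: continuous_bundle_def)
      from unit[OF normalize_in_sphere[OF this l False]] show ?thesis
        using False by (simp add: blinfun.scaleR_left)
    qed simp
    then have "u \<in> Q y" using L(2)[OF y(1)] by (auto simp: common_kernel_def)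
    then have "u = 0" using s(2) ds[OF y(1)] by (auto simp: direct_sum_def)
    then show False using s(2) by simp
  qed
  then obtain n where "\<forall>x\<in>K. \<forall>p\<in>P x. \<forall>q\<in>Q x. norm p \<le> real (Suc n) * norm (p + q)" by blast
  then show ?thesis using that[of "real (Suc n)"] by simp
qed

section \<open>Exponential separations\<close>

lemma exponential_separationD:
  assumes "exponential_separation k K F T P Q"
  shows "continuous_bundle k K P" "continuous_cobundle k K Q"
    and "x \<in> K \<Longrightarrow> P x \<in> grassmannian k"
    and "x \<in> K \<Longrightarrow> direct_sum (P x) (Q x)"
    and "x \<in> K \<Longrightarrow> blinfun_apply (T x) ` P x = P (F x)"
    and "x \<in> K \<Longrightarrow> blinfun_apply (T x) ` Q x \<subseteq> Q (F x)"
  using assms by (auto simp: exponential_separation_def continuous_bundle_def)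

text \<open>
  The rate estimate multiplied out by the norms, so that it applies to the components of an
  arbitrary vector, zero components included.
\<close>

lemma exponential_separation_rate:
  assumes "exponential_separation k K F T P Q"
  obtains M \<gamma> where "M > 0" "0 < \<gamma>" "\<gamma> < 1"
    "\<And>x v w n. x \<in> K \<Longrightarrow> v \<in> P x \<Longrightarrow> w \<in> Q x \<Longrightarrow> 1 \<le> n \<Longrightarrow>
      norm (cocycle_iter F T n x w) * norm v \<le> M * \<gamma> ^ n * norm (cocycle_iter F T n x v) * norm w"
proof -
  obtain M \<gamma> where M: "M > 0" "0 < \<gamma>" "\<gamma> < 1" and
    rate: "\<And>x v w n. x \<in> K \<Longrightarrow> v \<in> P x \<inter> sphere 0 1 \<Longrightarrow> w \<in> Q x \<inter> sphere 0 1 \<Longrightarrow> 1 \<le> n \<Longrightarrow>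
      norm (cocycle_iter F T n x w) \<le> M * \<gamma> ^ n * norm (cocycle_iter F T n x v)"
    using assms unfolding exponential_separation_def by (metis greaterThanLessThan_iff)
  have "norm (cocycle_iter F T n x w) * norm v
      \<le> M * \<gamma> ^ n * norm (cocycle_iter F T n x v) * norm w"
    if h: "x \<in> K" "v \<in> P x" "w \<in> Q x" "1 \<le> n" for x v w n
  proof (cases "v = 0 \<or> w = 0")
    case False
    have sub: "subspace (P x)" "subspace (Q x)"
      using exponential_separationD(4)[OF assms h(1)] by (auto simp: direct_sum_def)
    have "v /\<^sub>R norm v \<in> P x \<inter> sphere 0 1" "w /\<^sub>R norm w \<in> Q x \<inter> sphere 0 1"
      using False normalize_in_sphere[OF sub(1) h(2)] normalize_in_sphere[OF sub(2) h(3)]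
      by blast+
    from rate[OF h(1) this h(4)] show ?thesis
      using False by (simp add: blinfun.scaleR_right field_simps)
  qed auto
  then show ?thesis using that M by blast
qed

lemma cocycle_iter_fast_image:
  assumes sep: "exponential_separation k K F T P Q" and F: "F ` K = K" and x: "x \<in> K"
  shows "(F ^^ n) x \<in> K \<and> cocycle_iter F T n x ` P x = P ((F ^^ n) x)"
proof (induction n)
  case (Suc n)
  have "cocycle_iter F T (Suc n) x ` P x = T ((F ^^ n) x) ` cocycle_iter F T n x ` P x"
    by (simp add: image_image)
  then show ?case using Suc F exponential_separationD(5)[OF sep, of "(F ^^ n) x"] by auto
qed (use x in auto)

lemma cocycle_iter_slow_image:
  assumes sep: "exponential_separation k K F T P Q" and F: "F ` K = K" and x: "x \<in> K"
  shows "cocycle_iter F T n x ` Q x \<subseteq> Q ((F ^^ n) x)"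
proof (induction n)
  case (Suc n)
  have "(F ^^ n) x \<in> K" using cocycle_iter_fast_image[OF sep F x] by blast
  then show ?case using Suc exponential_separationD(6)[OF sep, of "(F ^^ n) x"] by fastforce
qed auto

lemma cocycle_iter_fast_nonzero:
  assumes sep: "exponential_separation k K F T P Q" and F: "F ` K = K" and x: "x \<in> K"
    and v: "v \<in> P x" "v \<noteq> 0"
  shows "cocycle_iter F T n x v \<noteq> 0"
proof
  assume 0: "cocycle_iter F T n x v = 0"
  have im: "(F ^^ n) x \<in> K" "cocycle_iter F T n x ` P x = P ((F ^^ n) x)"
    using cocycle_iter_fast_image[OF sep F x] by blast+
  have "inj_on (cocycle_iter F T n x) (P x)"
    by (rule linear_onto_equal_dim_inj[OF _ _ _ im(2)])
      (use exponential_separationD(3)[OF sep] x im(1) in \<open>auto intro: bounded_linear.linear blinfun.bounded_linear_right\<close>)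
  moreover have "0 \<in> P x"
    using exponential_separationD(3)[OF sep x] grassmannian_subspace subspace_0 by blast
  ultimately show False using 0 v by (metis blinfun.zero_right inj_onD)
qed

lemma homeomorphism_funpow_preimage:
  assumes "F ` K = K" "x \<in> K"
  obtains y where "y \<in> K" "(F ^^ n) y = x"
proof -
  have "(F ^^ n) ` K = K"
  proof (induction n)
    case (Suc n)
    have "(F ^^ Suc n) ` K = F ` (F ^^ n) ` K" by (simp add: image_image)
    then show ?case using Suc assms(1) by simp
  qed simp
  then show ?thesis using assms(2) that by (metis imageE)
qed

lemma exp_decay_le_zero:
  fixes a c g :: real
  assumes "0 < g" "g < 1" "\<And>n. 1 \<le> n \<Longrightarrow> a \<le> c * g ^ n"
  shows "a \<le> 0"
proof -
  have "(\<lambda>n. c * g ^ n) \<longlonglongrightarrow> c * 0"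
    by (intro tendsto_intros LIMSEQ_realpow_zero) (use assms in auto)
  then show ?thesis
    using LIMSEQ_le_const[of "\<lambda>n. c * g ^ n" "c * 0" a] assms(3) by auto
qed

section \<open>Comparing two separations\<close>

lemma slow_bundle_subset:
  assumes sep: "exponential_separation k K F T P Q"
    and sep': "exponential_separation k' K F T P' Q'"
    and F: "F ` K = K" and kk: "k \<le> k'" and x: "x \<in> K"
  shows "Q' x \<subseteq> Q x"
proof
  fix w assume w: "w \<in> Q' x"
  let ?A = "\<lambda>n v. norm (cocycle_iter F T n x v)"
  have ds: "direct_sum (P x) (Q x)" using exponential_separationD(4)[OF sep x] .
  obtain p q where pq: "p \<in> P x" "q \<in> Q x" "w = p + q" using direct_sumE[OF ds] .
  show "w \<in> Q x"
  proof (rule ccontr)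
    assume "w \<notin> Q x"
    then have p0: "p \<noteq> 0" using pq by auto
    obtain v a q1 where v: "v \<in> P' x" "v \<noteq> 0" "q1 \<in> Q x" "v = a *\<^sub>R p + q1"
      using exists_component_multiple[OF ds exponential_separationD(3)[OF sep x]
          exponential_separationD(3)[OF sep' x] kk pq(1) p0] .
    obtain M g where g: "M > 0" "0 < g" "g < 1" and
      rate: "\<And>v w n. v \<in> P x \<Longrightarrow> w \<in> Q x \<Longrightarrow> 1 \<le> n \<Longrightarrow>
        ?A n w * norm v \<le> M * g ^ n * ?A n v * norm w"
      using exponential_separation_rate[OF sep] x by metis
    obtain M' g' where g': "M' > 0" "0 < g'" "g' < 1" and
      rate': "\<And>v w n. v \<in> P' x \<Longrightarrow> w \<in> Q' x \<Longrightarrow> 1 \<le> n \<Longrightarrow>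
        ?A n w * norm v \<le> M' * g' ^ n * ?A n v * norm w"
      using exponential_separation_rate[OF sep'] x by metis
    \<comment> \<open>Everything is measured relative to \<open>?A n p\<close>: \<open>v\<close> stays bounded by \<open>D\<close>, the \<open>Q\<close>-part
      of \<open>w\<close> decays, and \<open>w\<close> decays because \<open>v\<close> is bounded. Hence \<open>p = w - q\<close> decays
      relative to itself. The larger rate \<open>h\<close> serves both decays.\<close>
    define D where "D = \<bar>a\<bar> + M * norm q1 / norm p"
    define h where "h = max g g'"
    define c where "c = M' * D * norm w / norm v + M * norm q / norm p"
    have D: "D \<ge> 0" using g by (simp add: D_def)
    have slow: "?A n z \<le> M * norm z / norm p * g ^ n * ?A n p"
      if "z \<in> Q x" "1 \<le> n" for z n
      using rate[OF pq(1) that] p0 by (simp add: field_simps)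
    have bound: "1 \<le> c * h ^ n" if n: "1 \<le> n" for n
    proof -
      have gn: "g ^ n \<le> h ^ n" "g' ^ n \<le> h ^ n" "g ^ n \<le> 1"
        using g g' by (auto simp: h_def intro!: power_mono power_le_one)
      have "?A n v \<le> \<bar>a\<bar> * ?A n p + ?A n q1"
        unfolding v(4) by (metis blinfun.add_right blinfun.scaleR_right norm_scaleR
            norm_triangle_ineq)
      also have "?A n q1 \<le> M * norm q1 / norm p * g ^ n * ?A n p" by (rule slow[OF v(3) n])
      also have "\<dots> \<le> M * norm q1 / norm p * 1 * ?A n p"
        using g gn by (intro mult_right_mono mult_left_mono) auto
      finally have vD: "?A n v \<le> D * ?A n p" by (simp add: D_def algebra_simps)
      have "?A n w \<le> M' * norm w / norm v * g' ^ n * ?A n v"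
        using rate'[OF v(1) w n] v(2) by (simp add: field_simps)
      also have "\<dots> \<le> M' * norm w / norm v * h ^ n * (D * ?A n p)"
        using g' gn vD g by (intro mult_mono mult_nonneg_nonneg) (auto simp: h_def)
      finally have wb: "?A n w \<le> M' * D * norm w / norm v * h ^ n * ?A n p"
        by (simp add: mult_ac)
      have "?A n q \<le> M * norm q / norm p * g ^ n * ?A n p" by (rule slow[OF pq(2) n])
      also have "\<dots> \<le> M * norm q / norm p * h ^ n * ?A n p"
        using g gn by (intro mult_right_mono mult_left_mono) auto
      finally have qb: "?A n q \<le> M * norm q / norm p * h ^ n * ?A n p" .
      have "p = w - q" using pq by simp
      then have "?A n p \<le> ?A n w + ?A n q"
        by (metis blinfun.diff_right norm_triangle_ineq4)
      also have "\<dots> \<le> c * h ^ n * ?A n p"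
        using add_mono[OF wb qb] by (simp add: c_def algebra_simps)
      finally show ?thesis
        using cocycle_iter_fast_nonzero[OF sep F x pq(1) p0, of n] by simp
    qed
    have "1 \<le> (0::real)"
      by (rule exp_decay_le_zero[OF _ _ bound]) (use g g' in \<open>auto simp: h_def\<close>)
    then show False by simp
  qed
qed

lemma fast_bundle_subset:
  assumes sep: "exponential_separation k K F T P Q"
    and sep': "exponential_separation k' K F T P' Q'"
    and K: "compact K" and F: "F ` K = K" and k: "1 \<le> k"
    and QQ: "\<And>x. x \<in> K \<Longrightarrow> Q' x \<subseteq> Q x" and x: "x \<in> K"
  shows "P x \<subseteq> P' x"
proof
  fix v assume v: "v \<in> P x"
  have ds: "direct_sum (P x) (Q x)" and ds': "direct_sum (P' x) (Q' x)"
    using exponential_separationD(4)[OF sep x] exponential_separationD(4)[OF sep' x] .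
  obtain p' q' where pq': "p' \<in> P' x" "q' \<in> Q' x" "v = p' + q'" using direct_sumE[OF ds'] .
  obtain C where C: "C > 0"
    "\<And>x p q. x \<in> K \<Longrightarrow> p \<in> P x \<Longrightarrow> q \<in> Q x \<Longrightarrow> norm p \<le> C * norm (p + q)"
    using uniform_angle[OF K k exponential_separationD(1,2)[OF sep]
        exponential_separationD(4)[OF sep]] by metis
  obtain M g where g: "M > 0" "0 < g" "g < 1" and
    rate: "\<And>y v w n. y \<in> K \<Longrightarrow> v \<in> P' y \<Longrightarrow> w \<in> Q' y \<Longrightarrow> 1 \<le> n \<Longrightarrow>
      norm (cocycle_iter F T n y w) * norm v \<le> M * g ^ n * norm (cocycle_iter F T n y v) * norm w"
    using exponential_separation_rate[OF sep'] by metis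
  show "v \<in> P' x"
  proof (cases "p' = 0")
    case True
    then have "v \<in> Q x" using pq' QQ[OF x] by auto
    then have "v = 0" using v ds by (auto simp: direct_sum_def)
    then show ?thesis using ds' by (simp add: direct_sum_def subspace_0)
  next
    case False
    have "norm q' \<le> M * norm p' * (C + 1) * g ^ n" if n: "1 \<le> n" for n
    proof -
      obtain y where y: "y \<in> K" "(F ^^ n) y = x" using homeomorphism_funpow_preimage[OF F x] .
      let ?A = "blinfun_apply (cocycle_iter F T n y)"
      obtain vn where vn: "vn \<in> P y" "?A vn = v"
        using cocycle_iter_fast_image[OF sep F y(1), of n] v y(2) by (metis imageE)
      obtain pn qn where pqn: "pn \<in> P' y" "qn \<in> Q' y" "vn = pn + qn"
        using direct_sumE[OF exponential_separationD(4)[OF sep' y(1)]] .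
      have A: "?A pn \<in> P' x" "?A qn \<in> Q' x"
        using cocycle_iter_fast_image[OF sep' F y(1), of n]
          cocycle_iter_slow_image[OF sep' F y(1), of n] pqn y(2) by blast+
      have "?A pn + ?A qn = p' + q'" using vn pqn pq' by (simp add: blinfun.add_right)
      note Apq = direct_sum_unique[OF ds' A(1) pq'(1) A(2) pq'(2) this]
      have pn0: "pn \<noteq> 0" using Apq(1) False by auto
      have "- qn \<in> Q y" using QQ[OF y(1)] pqn(2) exponential_separationD(4)[OF sep y(1)]
        by (auto simp: direct_sum_def subspace_neg)
      from C(2)[OF y(1) vn(1) this] have "norm vn \<le> C * norm pn" using pqn by simp
      moreover have "norm qn \<le> norm vn + norm pn"
        using norm_triangle_ineq4[of vn pn] pqn(3) by simp
      ultimately have qn: "norm qn \<le> (C + 1) * norm pn" by (simp add: algebra_simps)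
      have "norm q' * norm pn \<le> M * g ^ n * norm p' * norm qn"
        using rate[OF y(1) pqn(1,2) n] Apq by simp
      also have "\<dots> \<le> M * g ^ n * norm p' * ((C + 1) * norm pn)"
        using g qn by (intro mult_left_mono) auto
      finally have "norm q' * norm pn \<le> (M * norm p' * (C + 1) * g ^ n) * norm pn"
        by (simp add: mult_ac)
      then show ?thesis using pn0 by simp
    qed
    then have "norm q' \<le> 0" using exp_decay_le_zero[OF g(2,3)] by blast
    then show ?thesis using pq' by simp
  qed
qed

theorem lemma4p3:
  fixes K :: "'a::banach set"
    and F :: "'a \<Rightarrow> 'a"
    and T :: "'a \<Rightarrow> 'a \<Rightarrow>\<^sub>L 'a"
    and P Q P' Q' :: "'a \<Rightarrow> 'a set"
    and k k' :: nat
  assumes "compact K" and "K \<noteq> {}"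
    and "\<exists>G. homeomorphism K K F G"
    and "continuous_on K T"
    and "1 \<le> k" and "k \<le> k'"
    and "exponential_separation k K F T P Q"
    and "exponential_separation k' K F T P' Q'"
  shows "\<forall>x\<in>K. P x \<subseteq> P' x \<and> Q' x \<subseteq> Q x"
proof -
  have F: "F ` K = K" using assms(3) by (auto simp: homeomorphism_def)
  have "Q' x \<subseteq> Q x" if "x \<in> K" for x
    using slow_bundle_subset[OF assms(7,8) F assms(6) that] .
  then show ?thesis using fast_bundle_subset[OF assms(7,8,1) F assms(5)] by blast
qed

end
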